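(* Let $\phi(x)=a_0x^3+a_1x^2+a_2x+a_3$ with $a_i\in\mathbb{R}$, $a_0>0$, let $\gamma=\{(x,y)\in\mathbb{R}^2:y^2=\phi(x)\}$ be the corresponding cubic curve, and let $w(x)$ be a weight function on $\Omega_\gamma=\{x\in\mathbb{R}:\phi(x)>0\}$. Let $f$ be a continuous function on $\gamma$ and, for $x\in\Omega_\gamma$, let $$f_e(x)=\frac{f\big(x,\sqrt{\phi(x)}\big)+f\big(x,-\sqrt{\phi(x)}\big)}{2},\qquad f_o(x)=\frac{f\big(x,\sqrt{\phi(x)}\big)-f\big(x,-\sqrt{\phi(x)}\big)}{2\sqrt{\phi(x)}}.$$ For $n=0,1,2,\ldots$, let $N=N_n$ be defined by $N_{2m}=3m$ and $N_{2m+1}=3m+1$. Let $$\mathcal{L}_n(w;f,x,y):=L_N(w;f_e,x)+y\,L_N(w;f_o,x).$$ Then $\mathcal{L}_n(w;f)$ is a polynomial that satisfies $$\mathcal{L}_n(w;f,x_{k,N},y_{k,N})=f(x_{k,N},y_{k,N}),\qquad \mathcal{L}_n(w;f,x_{k,N},-y_{k,N})=f(x_{k,N},-y_{k,N}),\qquad 1\le k\le N,$$ where $x_{k,N}$, $1\le k\le N$, are the zeros of $p_N(w)$ and $y_{k,N}=\sqrt{\phi(x_{k,N})}$. Furthermore, it is the unique interpolation polynomial in $\Pi_n(\gamma)$ if $n=2m+1$ and in $\Pi_n(\gamma)\cup\{Y_{2m+1,3}\}$ if $n=2m$.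
   Context: A weight function $w$ on $\Omega_\gamma$ is a nonnegative function, not almost everywhere zero, with all moments $\int_{\Omega_\gamma}|x|^kw(x)\,\mathrm{d}x$ finite. $\Pi_n(\gamma)$ is the space of polynomials in $x,y$ of total degree at most $n$ restricted to $\gamma$ (equivalently, taken modulo $y^2-\phi(x)$). For $v=w$ or $v=\phi w$, $\{p_k(v)\}_{k\ge0}$, $\deg p_k(v)=k$, are the univariate orthogonal polynomials with respect to $\langle f,g\rangle_v=\int_{\Omega_\gamma}f(x)g(x)v(x)\,\mathrm{d}x$, with values $p_k(v;x)$. $Y_{2m+1,3}(x,y)=y\,p_{3m-1}(\phi w;x)$ (with $p_{-1}=0$ when $m=0$), and $\Pi_n(\gamma)\cup\{Y_{2m+1,3}\}$ denotes the linear space generated by $\Pi_n(\gamma)$ and $Y_{2m+1,3}$. For a function $g$ on $\Omega_\gamma$, $L_N(w;g)$, with values $L_N(w;g,x)$, is the univariate Lagrange interpolation polynomial at the zeros of $p_N(w)$: the unique polynomial of degree at most $N-1$ with $L_N(w;g,x_{k,N})=g(x_{k,N})$, $1\le k\le N$ (the zero polynomial if $N=0$).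
   Formalization: Uniqueness as stated fails for every n (add any multiple of p_N(w)); proved instead: the interpolants in the space are exactly L_n + c p_N(w), and L_n is the only one with even part orthogonal to p_N(w). All zeros of p_N(w) are assumed to lie in Ω_γ, where f_e and f_o are defined. *)

theory Defs
  imports "HOL-Analysis.Analysis" "HOL-Computational_Algebra.Polynomial"
begin

definition curve :: "real poly \<Rightarrow> (real \<times> real) set" where
  "curve \<phi> = {(x, y). y\<^sup>2 = poly \<phi> x}"

definition Omega :: "real poly \<Rightarrow> real set" where
  "Omega \<phi> = {x. poly \<phi> x > 0}"

definition weight_on :: "real set \<Rightarrow> (real \<Rightarrow> real) \<Rightarrow> bool" where
  "weight_on S w \<longleftrightarrow>
     (\<forall>x\<in>S. 0 \<le> w x) \<and>
     \<not> (AE x in lebesgue. x \<in> S \<longrightarrow> w x = 0) \<and>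
     (\<forall>k::nat. set_integrable lebesgue S (\<lambda>x. \<bar>x\<bar> ^ k * w x))"

definition inner_w :: "real set \<Rightarrow> (real \<Rightarrow> real) \<Rightarrow> (real \<Rightarrow> real) \<Rightarrow> (real \<Rightarrow> real) \<Rightarrow> real" where
  "inner_w S v f g = (LINT x:S|lebesgue. f x * g x * v x)"

text \<open>No normalization is chosen: the system is determined up to nonzero factors.
  The condition \<^term>\<open>p k \<noteq> 0\<close> only matters for \<^term>\<open>k = 0\<close>.\<close>

definition orthogonal_polys :: "real set \<Rightarrow> (real \<Rightarrow> real) \<Rightarrow> (nat \<Rightarrow> real poly) \<Rightarrow> bool" where
  "orthogonal_polys S v p \<longleftrightarrow>
     (\<forall>k. p k \<noteq> 0 \<and> degree (p k) = k) \<and>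
     (\<forall>j k. j \<noteq> k \<longrightarrow> inner_w S v (poly (p j)) (poly (p k)) = 0)"

text \<open>The zeros are listed in increasing order, with the index \<open>k\<close> running from 1.\<close>

definition node :: "real poly \<Rightarrow> nat \<Rightarrow> real" where
  "node P k = sorted_list_of_set {x. poly P x = 0} ! (k - 1)"

definition lagrange :: "(nat \<Rightarrow> real poly) \<Rightarrow> nat \<Rightarrow> (real \<Rightarrow> real) \<Rightarrow> real poly" where
  "lagrange p N g =
     (THE L. (L = 0 \<or> degree L < N) \<and>
             (\<forall>k\<in>{1..N}. poly L (node (p N) k) = g (node (p N) k)))"

definition even_part :: "real poly \<Rightarrow> (real \<times> real \<Rightarrow> real) \<Rightarrow> real \<Rightarrow> real" where
  "even_part \<phi> f x = (f (x, sqrt (poly \<phi> x)) + f (x, - sqrt (poly \<phi> x))) / 2"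

definition odd_part :: "real poly \<Rightarrow> (real \<times> real \<Rightarrow> real) \<Rightarrow> real \<Rightarrow> real" where
  "odd_part \<phi> f x =
     (f (x, sqrt (poly \<phi> x)) - f (x, - sqrt (poly \<phi> x))) / (2 * sqrt (poly \<phi> x))"

definition num_nodes :: "nat \<Rightarrow> nat" where
  "num_nodes n = (if even n then 3 * (n div 2) else 3 * (n div 2) + 1)"

definition curve_interp ::
  "real poly \<Rightarrow> (nat \<Rightarrow> real poly) \<Rightarrow> nat \<Rightarrow> (real \<times> real \<Rightarrow> real) \<Rightarrow> real \<times> real \<Rightarrow> real" where
  "curve_interp \<phi> p n f = (\<lambda>(x, y).
     poly (lagrange p (num_nodes n) (even_part \<phi> f)) x +
     y * poly (lagrange p (num_nodes n) (odd_part \<phi> f)) x)"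

text \<open>A bivariate polynomial is an element of \<open>\<real>[x][y]\<close>: the outer variable is \<open>y\<close>.\<close>

definition eval2 :: "real poly poly \<Rightarrow> real \<times> real \<Rightarrow> real" where
  "eval2 P = (\<lambda>(x, y). poly (poly P [:y:]) x)"

definition total_degree_le :: "real poly poly \<Rightarrow> nat \<Rightarrow> bool" where
  "total_degree_le P n \<longleftrightarrow> (\<forall>i j. coeff (coeff P j) i \<noteq> 0 \<longrightarrow> i + j \<le> n)"

text \<open>Functions on the curve are represented extensionally (by \<^const>\<open>restrict\<close>), so that
  their equality is equality on the curve.\<close>

definition Pi_curve :: "real poly \<Rightarrow> nat \<Rightarrow> (real \<times> real \<Rightarrow> real) set" where
  "Pi_curve \<phi> n = {restrict (eval2 P) (curve \<phi>) | P. total_degree_le P n}"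

text \<open>The space generated by a linear space \<open>V\<close> of functions on the curve and one more
  function \<open>Y\<close>.\<close>

definition adjoin ::
  "real poly \<Rightarrow> (real \<times> real \<Rightarrow> real) set \<Rightarrow> (real \<times> real \<Rightarrow> real) \<Rightarrow> (real \<times> real \<Rightarrow> real) set"
where
  "adjoin \<phi> V Y = {restrict (\<lambda>z. F z + c * Y z) (curve \<phi>) | F c. F \<in> V}"

text \<open>\<open>Y_odd3 q m\<close> is the function \<open>Y\<^bsub>2m+1,3\<^esub>\<close>, where \<open>q\<close> is the orthogonal system
  for the weight \<open>\<phi>w\<close>.\<close>

definition Y_odd3 :: "(nat \<Rightarrow> real poly) \<Rightarrow> nat \<Rightarrow> real \<times> real \<Rightarrow> real" where
  "Y_odd3 q m = (\<lambda>(x, y). if m = 0 then 0 else y * poly (q (3 * m - 1)) x)"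

definition interp_space :: "real poly \<Rightarrow> (nat \<Rightarrow> real poly) \<Rightarrow> nat \<Rightarrow> (real \<times> real \<Rightarrow> real) set" where
  "interp_space \<phi> q n =
     (if odd n then Pi_curve \<phi> n else adjoin \<phi> (Pi_curve \<phi> n) (Y_odd3 q (n div 2)))"

definition interpolates ::
  "real poly \<Rightarrow> real poly \<Rightarrow> nat \<Rightarrow> (real \<times> real \<Rightarrow> real) \<Rightarrow> (real \<times> real \<Rightarrow> real) \<Rightarrow> bool" where
  "interpolates \<phi> P N f F \<longleftrightarrow>
     (\<forall>k\<in>{1..N}. let x = node P k; y = sqrt (poly \<phi> x) in
        F (x, y) = f (x, y) \<and> F (x, - y) = f (x, - y))"

end

theory Submission
  imports Defs
begin

text \<open>Reducing by \<open>y\<^sup>2 = \<phi> x\<close>, the interpolation space consists of the functions \<open>A x + y B x\<close> with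
  \<open>degree A \<le> N\<close> and \<open>degree B < N\<close>. By orthogonality \<open>p N\<close> has \<open>N\<close> distinct real zeros, and since
  \<open>y\<^bsub>k,N\<^esub> > 0\<close> there, interpolating \<open>f\<close> at both points over a zero means that \<open>A\<close> interpolates
  the even part and \<open>B\<close> the odd part. So \<open>B\<close> is a Lagrange polynomial, while \<open>A\<close> is one up to
  a multiple of \<open>p N\<close>, which the orthogonality condition excludes.\<close>

section \<open>Polynomials of bounded degree and interpolation by them\<close>

text \<open>Stated through coefficients because \<open>degree 0 = 0\<close>: closure under sums then
  needs no separate case for the zero polynomial, and \<open>polys_lt 0\<close> is the zero
  space.\<close>

definition polys_lt :: "nat \<Rightarrow> 'a::zero poly set" where
  "polys_lt d = {P. \<forall>i\<ge>d. coeff P i = 0}"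

lemma polys_lt_iff: "P \<in> polys_lt d \<longleftrightarrow> P = 0 \<or> degree P < d"
proof
  assume "P \<in> polys_lt d"
  then show "P = 0 \<or> degree P < d"
    by (cases "degree P < d") (auto simp: polys_lt_def not_less)
qed (auto simp: polys_lt_def coeff_eq_0)

lemma polys_lt_0 [simp]: "polys_lt 0 = {0}"
  by (auto simp: polys_lt_iff)

lemma polys_lt_Suc: "P \<in> polys_lt (Suc d) \<longleftrightarrow> degree P \<le> d"
  by (auto simp: polys_lt_iff)

lemma polys_lt_zero [simp]: "0 \<in> polys_lt d"
  by (simp add: polys_lt_def)

lemma polys_lt_mono: "P \<in> polys_lt d \<Longrightarrow> d \<le> e \<Longrightarrow> P \<in> polys_lt e"
  by (auto simp: polys_lt_def)

lemma polys_lt_add: "P \<in> polys_lt d \<Longrightarrow> Q \<in> polys_lt d \<Longrightarrow> P + Q \<in> polys_lt d"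
  by (auto simp: polys_lt_def)

lemma polys_lt_diff:
  fixes P Q :: "'a::ab_group_add poly"
  shows "P \<in> polys_lt d \<Longrightarrow> Q \<in> polys_lt d \<Longrightarrow> P - Q \<in> polys_lt d"
  by (auto simp: polys_lt_def)

lemma polys_lt_smult: "P \<in> polys_lt d \<Longrightarrow> smult c P \<in> polys_lt d"
  by (auto simp: polys_lt_def)

text \<open>A multiple of \<open>Q\<close> cancels the coefficient at \<open>d\<close>. This
  splitting serves the orthogonality induction, the adjoined function and the top coefficient of the
  even part.\<close>

lemma polys_lt_split_leading:
  fixes P Q :: "'a::field poly"
  assumes "P \<in> polys_lt (Suc d)" "Q \<noteq> 0" "degree Q = d"
  obtains c R where "R \<in> polys_lt d" "P = R + smult c Q"
proof -
  define c where "c = coeff P d / coeff Q d"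
  have "coeff Q d \<noteq> 0" using assms by auto
  then have "coeff (P - smult c Q) i = 0" if "i \<ge> d" for i
    using that assms(1,3) by (cases "i = d") (auto simp: c_def polys_lt_def coeff_eq_0)
  then have "P - smult c Q \<in> polys_lt d" by (simp add: polys_lt_def)
  then show thesis using that[of "P - smult c Q" c] by simp
qed

text \<open>A root count; applied to differences, it is the uniqueness half of each interpolation
  argument below.\<close>

lemma polys_lt_eq_0:
  fixes P :: "'a::idom poly"
  assumes "P \<in> polys_lt (card X)" "\<And>x. x \<in> X \<Longrightarrow> poly P x = 0"
  shows "P = 0"
proof (rule ccontr)
  assume "P \<noteq> 0"
  then have "card X \<le> card {x. poly P x = 0}"
    by (intro card_mono poly_roots_finite) (use assms in auto)
  also have "\<dots> \<le> degree P" using \<open>P \<noteq> 0\<close> by (rule card_poly_roots_bound)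
  finally show False using assms \<open>P \<noteq> 0\<close> by (simp add: polys_lt_iff)
qed

text \<open>Newton's scheme: a new node is met by adding a multiple of the polynomial that vanishes
  exactly at the old ones.\<close>

lemma lagrange_exists:
  fixes g :: "'a::field \<Rightarrow> 'a"
  assumes "finite X"
  shows "\<exists>L \<in> polys_lt (card X). \<forall>x\<in>X. poly L x = g x"
  using assms
proof (induction X)
  case empty
  then show ?case by simp
next
  case (insert a X)
  then obtain L where L: "L \<in> polys_lt (card X)" "\<And>x. x \<in> X \<Longrightarrow> poly L x = g x" by blast
  define Q where "Q = (\<Prod>r\<in>X. [:- r, 1:])"
  have Q0: "poly Q a \<noteq> 0" using insert by (auto simp: Q_def poly_prod)
  have QX: "poly Q x = 0" if "x \<in> X" for x
    using insert that by (auto simp: Q_def poly_prod)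
  have dQ: "degree Q = card X" by (simp add: Q_def degree_prod_eq_sum_degree)
  define M where "M = L + smult ((g a - poly L a) / poly Q a) Q"
  have "M \<in> polys_lt (card (insert a X))"
    unfolding M_def using insert.hyps
    by (intro polys_lt_add polys_lt_smult polys_lt_mono[OF L(1)])
       (auto simp: polys_lt_Suc dQ)
  moreover have "\<forall>x\<in>insert a X. poly M x = g x"
    using Q0 QX L(2) by (simp add: M_def)
  ultimately show ?case by blast
qed

section \<open>Zeros of orthogonal polynomials\<close>

text \<open>\<open>Z\<close> is the set of roots of odd multiplicity.\<close>

lemma poly_roots_sign_decomposition:
  fixes P :: "real poly"
  assumes "P \<noteq> 0"
  shows "\<exists>Z S. finite Z \<and> Z \<subseteq> {x. poly P x = 0} \<and> P = (\<Prod>r\<in>Z. [:- r, 1:]) * S \<and>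
           ((\<forall>x. 0 \<le> poly S x) \<or> (\<forall>x. poly S x \<le> 0))"
  using assms
proof (induction "degree P" arbitrary: P rule: less_induct)
  case less
  show ?case
  proof (cases "\<exists>a. poly P a = 0")
    case False
    have "(\<forall>x. 0 \<le> poly P x) \<or> (\<forall>x. poly P x \<le> 0)"
    proof (rule ccontr)
      assume "\<not> ?thesis"
      then obtain x y where xy: "poly P x < 0" "0 < poly P y" by (auto simp: not_le)
      then have "x \<noteq> y" by auto
      then show False
        using poly_IVT_pos[of x y P] poly_IVT_neg[of y x P] xy False
        by (cases "x < y") auto
    qed
    then show ?thesis by (intro exI[of _ "{}"] exI[of _ P]) simp
  next
    case True
    then obtain a where "poly P a = 0" by blast
    then obtain P' where P': "P = [:- a, 1:] * P'"
      by (auto simp: poly_eq_0_iff_dvd)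
    with less.prems have "P' \<noteq> 0" by auto
    then have "degree P = Suc (degree P')"
      unfolding P' by (subst degree_mult_eq) auto
    with less.hyps[of P'] \<open>P' \<noteq> 0\<close> obtain Z S where
      Z: "finite Z" "Z \<subseteq> {x. poly P' x = 0}" "P' = (\<Prod>r\<in>Z. [:- r, 1:]) * S"
      and S: "(\<forall>x. 0 \<le> poly S x) \<or> (\<forall>x. poly S x \<le> 0)" by auto
    have roots: "insert a Z \<subseteq> {x. poly P x = 0}" using Z(2) by (auto simp: P')
    show ?thesis
    proof (cases "a \<in> Z")
      case False
      have "P = (\<Prod>r\<in>insert a Z. [:- r, 1:]) * S"
        using Z(1) False by (simp add: P' Z(3) ac_simps del: mult_pCons_left)
      then show ?thesis using Z(1) roots S by blast
    next
      case True
      \<comment> \<open>One more factor at \<open>a\<close> makes its multiplicity even, so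
        \<open>a\<close> leaves \<open>Z\<close> and the square of \<open>x - a\<close> joins the
        factor of constant sign.\<close>
      define T where "T = [:- a, 1:]\<^sup>2 * S"
      have "P = (\<Prod>r\<in>Z - {a}. [:- r, 1:]) * T"
        using Z(1) True
        by (simp add: P' Z(3) T_def prod.remove[of Z a] power2_eq_square ac_simps
              del: mult_pCons_left mult_pCons_right)
      moreover have "poly T x = (x - a)\<^sup>2 * poly S x" for x
        by (simp add: T_def poly_power)
      then have "(\<forall>x. 0 \<le> poly T x) \<or> (\<forall>x. poly T x \<le> 0)"
        using S by (auto intro: mult_nonneg_nonneg mult_nonneg_nonpos)
      ultimately show ?thesis using Z(1) roots
        by (intro exI[of _ "Z - {a}"] exI[of _ T]) auto
    qed
  qed
qed

lemma set_integrable_poly_weight: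
  assumes "weight_on S w"
  shows "set_integrable lebesgue S (\<lambda>x. poly P x * w x)"
proof -
  have mono: "set_integrable lebesgue S (\<lambda>x. x ^ i * w x)" for i
  proof -
    \<comment> \<open>The moment with \<open>k = 0\<close> yields measurability of \<open>w\<close>
      on \<open>S\<close>; the absolute moment of order \<open>i\<close> then dominates the signed
      one.\<close>
    have w0: "set_integrable lebesgue S w" and wi: "set_integrable lebesgue S (\<lambda>x. \<bar>x\<bar> ^ i * w x)"
      using assms unfolding weight_on_def by (force dest: spec[of _ "0::nat"])+
    have [measurable]: "(\<lambda>x. indicator S x *\<^sub>R w x) \<in> borel_measurable lebesgue"
      using w0 unfolding set_integrable_def by (rule borel_measurable_integrable)
    have "(\<lambda>x::real. x ^ i) \<in> borel_measurable lebesgue"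
      by (intro measurable_completion) simp
    then have "(\<lambda>x. x ^ i * (indicator S x *\<^sub>R w x)) \<in> borel_measurable lebesgue"
      by measurable
    then have "(\<lambda>x. indicator S x *\<^sub>R (x ^ i * w x)) \<in> borel_measurable lebesgue"
      by (simp add: ac_simps)
    with wi show ?thesis
      unfolding set_integrable_def
      by (rule Bochner_Integration.integrable_bound) (auto simp: abs_mult power_abs)
  qed
  have "set_integrable lebesgue S (\<lambda>x. \<Sum>i\<le>degree P. coeff P i * (x ^ i * w x))"
    using mono unfolding set_integrable_def scaleR_sum_right
    by (intro Bochner_Integration.integrable_sum)
       (simp add: mult.left_commute[of "indicator _ _"])
  then show ?thesis by (simp add: poly_altdef sum_distrib_right mult.assoc)
qed

lemma inner_w_poly: "inner_w S w (poly P) (poly Q) = (LINT x:S|lebesgue. poly (P * Q) x * w x)"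
  by (simp add: inner_w_def)

text \<open>Linearity in the shape that \<open>polys_lt_split_leading\<close> produces.\<close>

lemma inner_w_add_smult:
  assumes "weight_on S w"
  shows "inner_w S w (poly (P + smult c P')) (poly Q) =
           inner_w S w (poly P) (poly Q) + c * inner_w S w (poly P') (poly Q)"
proof -
  have "(\<lambda>x. poly ((P + smult c P') * Q) x * w x) =
      (\<lambda>x. poly (P * Q) x * w x + c * (poly (P' * Q) x * w x))"
    by (auto simp: algebra_simps)
  then show ?thesis
    unfolding inner_w_poly
    using set_integrable_poly_weight[OF assms, of "P * Q"]
      set_integrable_poly_weight[OF assms, of "P' * Q"]
    by (simp add: set_integral_add set_integrable_mult_right)
qed

text \<open>A zero integral would make the integrand vanish almost everywhere; the zeros of
  \<open>P\<close> form a finite, hence null, set, so \<open>w\<close> itself would vanish almost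
  everywhere on \<open>S\<close>.\<close>

lemma weighted_integral_nonneg_poly_neq_0:
  assumes w: "weight_on S w" and P: "P \<noteq> 0" and nonneg: "\<And>x. 0 \<le> poly P x"
  shows "(LINT x:S|lebesgue. poly P x * w x) \<noteq> 0"
proof
  assume "(LINT x:S|lebesgue. poly P x * w x) = 0"
  moreover have "AE x in lebesgue. 0 \<le> indicator S x *\<^sub>R (poly P x * w x)"
    using w nonneg by (intro AE_I2) (auto simp: weight_on_def indicator_def)
  ultimately have "AE x in lebesgue. indicator S x *\<^sub>R (poly P x * w x) = 0"
    using integral_nonneg_eq_0_iff_AE[OF set_integrable_poly_weight[OF w, of P,
        unfolded set_integrable_def]]
    by (simp add: set_lebesgue_integral_def)
  moreover have "AE x in lebesgue. x \<notin> {x. poly P x = 0}"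
    using poly_roots_finite[OF P]
    by (intro AE_not_in) (simp add: negligible_iff_null_sets[symmetric] negligible_finite)
  ultimately have "AE x in lebesgue. x \<in> S \<longrightarrow> w x = 0"
    by eventually_elim auto
  with w show False by (simp add: weight_on_def)
qed

lemma inner_w_self_neq_0:
  assumes "weight_on S w" "P \<noteq> 0"
  shows "inner_w S w (poly P) (poly P) \<noteq> 0"
  unfolding inner_w_poly
  by (intro weighted_integral_nonneg_poly_neq_0) (use assms in auto)

text \<open>\<open>Q\<close> is expanded in the \<open>p k\<close> with \<open>k < N\<close>, one
  leading term at a time, and each of these is orthogonal to \<open>p N\<close>.\<close>

lemma orthogonal_polys_polys_lt:
  assumes w: "weight_on S w" and p: "orthogonal_polys S w p" and Q: "Q \<in> polys_lt N"
  shows "inner_w S w (poly Q) (poly (p N)) = 0"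
proof -
  have "inner_w S w (poly Q) (poly (p N)) = 0" if "Q \<in> polys_lt k" "k \<le> N" for k
    using that
  proof (induction k arbitrary: Q)
    case 0
    then show ?case by (simp add: inner_w_def)
  next
    case (Suc k)
    have "p k \<noteq> 0" "degree (p k) = k" using p by (auto simp: orthogonal_polys_def)
    with Suc.prems(1) obtain c R where R: "R \<in> polys_lt k" "Q = R + smult c (p k)"
      using polys_lt_split_leading by blast
    have "inner_w S w (poly (p k)) (poly (p N)) = 0"
      using p Suc.prems(2) by (auto simp: orthogonal_polys_def)
    then show ?case
      using Suc.IH[OF R(1)] Suc.prems(2) by (simp only: R(2) inner_w_add_smult[OF w])
  qed
  with Q show ?thesis by blast
qed

text \<open>With fewer than \<open>N\<close> sign changes, the product \<open>Q\<close> of the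
  linear factors at them would be orthogonal to \<open>p N\<close>, although \<open>Q * p N\<close>
  is a square times a factor of constant sign. Sign changes are counted on the whole line, so zeros
  outside \<open>S\<close> remain possible.\<close>

lemma card_roots_orthogonal_poly:
  assumes w: "weight_on S w" and p: "orthogonal_polys S w p"
  shows "card {x. poly (p N) x = 0} = N"
proof -
  have p0: "p N \<noteq> 0" and dp: "degree (p N) = N" using p by (auto simp: orthogonal_polys_def)
  obtain Z T where Z: "finite Z" "Z \<subseteq> {x. poly (p N) x = 0}" "p N = (\<Prod>r\<in>Z. [:- r, 1:]) * T"
    and T: "(\<forall>x. 0 \<le> poly T x) \<or> (\<forall>x. poly T x \<le> 0)"
    using poly_roots_sign_decomposition[OF p0] by blast
  define Q where "Q = (\<Prod>r\<in>Z. [:- r, 1:])"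
  have dQ: "degree Q = card Z" by (simp add: Q_def degree_prod_eq_sum_degree)
  have pQ: "p N = Q * T" using Z(3) by (simp add: Q_def)
  have Q0: "Q * p N \<noteq> 0" using p0 pQ by auto
  have sq: "poly (Q * p N) x = (poly Q x)\<^sup>2 * poly T x" for x
    by (simp add: pQ power2_eq_square)
  have "inner_w S w (poly Q) (poly (p N)) \<noteq> 0"
  proof (cases "\<forall>x. 0 \<le> poly T x")
    case True
    then show ?thesis unfolding inner_w_poly
      by (intro weighted_integral_nonneg_poly_neq_0 w Q0) (simp only: sq, simp)
  next
    case False
    with T have "\<forall>x. poly T x \<le> 0" by blast
    then have "(LINT x:S|lebesgue. poly (- (Q * p N)) x * w x) \<noteq> 0"
      using Q0 by (intro weighted_integral_nonneg_poly_neq_0 w)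
        (simp_all only: sq poly_minus neg_0_le_iff_le neg_equal_0_iff_equal
          mult_nonneg_nonpos zero_le_power2 not_False_eq_True)
    then show ?thesis by (simp add: inner_w_poly set_lebesgue_integral_def)
  qed
  then have "Q \<notin> polys_lt N" using orthogonal_polys_polys_lt[OF w p] by blast
  then have "N \<le> card Z" by (auto simp: polys_lt_iff dQ)
  also have "card Z \<le> card {x. poly (p N) x = 0}"
    by (intro card_mono poly_roots_finite p0 Z)
  finally show ?thesis using card_poly_roots_bound[OF p0] dp by simp
qed

section \<open>Lagrange interpolation at the zeros\<close>

text \<open>Lets later arguments range over the zero set instead of indices; nodes count from 1,
  list positions from 0.\<close>

lemma node_image:
  assumes "P \<noteq> 0"
  shows "node P ` {1..card {x. poly P x = 0}} = {x. poly P x = 0}"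
proof -
  let ?X = "{x. poly P x = 0}"
  let ?xs = "sorted_list_of_set ?X"
  have fin: "finite ?X" using assms by (rule poly_roots_finite)
  have "node P ` {1..card ?X} = (\<lambda>k. ?xs ! k) ` (\<lambda>k. k - 1) ` {1..card ?X}"
    by (simp add: node_def image_image)
  also have "(\<lambda>k. k - 1) ` {1..card ?X} = {..<card ?X}"
    by (force simp: image_iff Bex_def intro: exI[of _ "Suc _"])
  also have "(\<lambda>k. ?xs ! k) ` {..<card ?X} = set ?xs"
    by (auto simp: set_conv_nth length_sorted_list_of_set)
  finally show ?thesis using fin by simp
qed

text \<open>Resolves the definite description in \<open>lagrange\<close>: existence by Newton's
  scheme, uniqueness because the difference of two candidates lies in \<open>polys_lt N\<close> and
  has \<open>N\<close> zeros.\<close>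

lemma lagrange_props:
  assumes p0: "p N \<noteq> 0" and card: "card {x. poly (p N) x = 0} = N"
  shows "lagrange p N g \<in> polys_lt N"
    and "poly (p N) x = 0 \<Longrightarrow> poly (lagrange p N g) x = g x"
proof -
  let ?X = "{x. poly (p N) x = 0}"
  have im: "node (p N) ` {1..N} = ?X" using node_image[OF p0] card by simp
  let ?I = "\<lambda>L. (L = 0 \<or> degree L < N) \<and> (\<forall>k\<in>{1..N}. poly L (node (p N) k) = g (node (p N) k))"
  have eq: "?I L \<longleftrightarrow> L \<in> polys_lt N \<and> (\<forall>x\<in>?X. poly L x = g x)" for L
    unfolding im[symmetric] by (simp add: polys_lt_iff)
  have "\<exists>!L. ?I L"
    unfolding eq
  proof (rule ex_ex1I)
    show "\<exists>L. L \<in> polys_lt N \<and> (\<forall>x\<in>?X. poly L x = g x)"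
      using lagrange_exists[OF poly_roots_finite[OF p0], of g] card by auto
    fix L M
    assume "L \<in> polys_lt N \<and> (\<forall>x\<in>?X. poly L x = g x)" "M \<in> polys_lt N \<and> (\<forall>x\<in>?X. poly M x = g x)"
    then have "L - M = 0"
      by (intro polys_lt_eq_0[of _ ?X] polys_lt_diff) (auto simp: card)
    then show "L = M" by simp
  qed
  from theI'[OF this] have "lagrange p N g \<in> polys_lt N \<and> (\<forall>x\<in>?X. poly (lagrange p N g) x = g x)"
    unfolding lagrange_def[symmetric] unfolding eq .
  then show "lagrange p N g \<in> polys_lt N" "poly (p N) x = 0 \<Longrightarrow> poly (lagrange p N g) x = g x"
    by auto
qed

section \<open>Normal forms of polynomials on the curve\<close>

text \<open>Modulo \<open>y^2 - \<phi>\<close>, the polynomials form a free module over those in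
  \<open>x\<close>, with basis 1 and \<open>y\<close>; \<open>A\<close> and \<open>B\<close> are the
  coordinates.\<close>

definition curve_fun :: "real poly \<Rightarrow> real poly \<Rightarrow> real \<times> real \<Rightarrow> real" where
  "curve_fun A B = (\<lambda>(x, y). poly A x + y * poly B x)"

lemma eval2_pCons [simp]: "eval2 (pCons A P) (x, y) = poly A x + y * eval2 P (x, y)"
  by (simp add: eval2_def)

lemma eval2_0 [simp]: "eval2 0 z = 0"
  by (simp add: eval2_def split: prod.split)

lemma eval2_add [simp]: "eval2 (P + Q) z = eval2 P z + eval2 Q z"
  by (simp add: eval2_def split: prod.split)

lemma curve_fun_eq_eval2: "curve_fun A B = eval2 [:A, B:]"
  by (auto simp: curve_fun_def)

text \<open>\<open>pCons A P\<close> stands for \<open>A + y P\<close>, and the factor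
  \<open>y\<close> uses up one degree. This drives the inductions on the total degree.\<close>

lemma total_degree_le_pCons_Suc:
  "total_degree_le (pCons A P) (Suc n) \<longleftrightarrow> degree A \<le> Suc n \<and> total_degree_le P n"
proof -
  have "degree A \<le> Suc n \<longleftrightarrow> (\<forall>i. coeff A i \<noteq> 0 \<longrightarrow> i \<le> Suc n)"
    by (meson degree_le le_degree order_trans not_le)
  then show ?thesis
    unfolding total_degree_le_def
    by (auto simp: coeff_pCons split: nat.splits)
qed

lemma total_degree_le_0: "total_degree_le P 0 \<Longrightarrow> \<exists>c. P = [:[:c:]:]"
proof -
  assume P: "total_degree_le P 0"
  have "P = [:[:coeff (coeff P 0) 0:]:]"
    using P by (intro poly_eqI) (auto simp: total_degree_le_def coeff_pCons split: nat.splits)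
  then show ?thesis by blast
qed

lemma total_degree_le_add:
  "total_degree_le P n \<Longrightarrow> total_degree_le Q n \<Longrightarrow> total_degree_le (P + Q) n"
  unfolding total_degree_le_def by (metis add.right_neutral coeff_add)

lemma total_degree_le_const: "degree A \<le> n \<Longrightarrow> total_degree_le [:A:] n"
  by (auto simp: total_degree_le_def coeff_pCons split: nat.splits dest: le_degree)

text \<open>On the curve \<open>y\<^sup>2 = \<phi>\<close> has degree 3 in \<open>x\<close>, so trading \<open>\<phi>\<close> for \<open>y\<^sup>2\<close> saves one degree;
  this is where the bounds \<open>n + n div 2\<close> come from.
  Note that \<open>0 + (0 - 1) div 2 = 0\<close>, so for \<open>n = 0\<close> the odd part vanishes.\<close>

lemma eval2_eq_curve_fun:
  assumes phi: "degree \<phi> = 3"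
    and "total_degree_le P n"
  shows "\<exists>A\<in>polys_lt (Suc (n + n div 2)). \<exists>B\<in>polys_lt (n + (n - 1) div 2).
           \<forall>z\<in>curve \<phi>. eval2 P z = curve_fun A B z"
  using assms(2)
proof (induction n arbitrary: P)
  case 0
  then obtain c where "P = [:[:c:]:]" using total_degree_le_0 by blast
  then show ?case
    by (intro bexI[of _ "[:c:]"] bexI[of _ 0]) (auto simp: polys_lt_Suc curve_fun_def)
next
  case (Suc n)
  obtain A0 P' where P: "P = pCons A0 P'" by (cases P)
  with Suc.prems have A0: "degree A0 \<le> Suc n" and "total_degree_le P' n"
    by (auto simp: total_degree_le_pCons_Suc)
  with Suc.IH obtain A B where A: "A \<in> polys_lt (Suc (n + n div 2))"
    and B: "B \<in> polys_lt (n + (n - 1) div 2)"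
    and AB: "\<And>z. z \<in> curve \<phi> \<Longrightarrow> eval2 P' z = curve_fun A B z" by blast
  \<comment> \<open>On the curve \<open>A0 + y (A + y B) = (A0 + \<phi> B) + y A\<close>, so the two
    parts swap roles. For \<open>n = 0\<close> the bound on \<open>B\<close> leaves only
    \<open>B = 0\<close>.\<close>
  have "B = 0 \<or> degree (\<phi> * B) < Suc (Suc n + Suc n div 2)"
  proof (cases "B = 0")
    case False
    then have "degree B < n + (n - 1) div 2" using B by (simp add: polys_lt_iff)
    then have "3 + degree B < Suc (Suc n + Suc n div 2)" by (cases n) auto
    then show ?thesis using degree_mult_le[of \<phi> B] phi by linarith
  qed simp
  then have "\<phi> * B \<in> polys_lt (Suc (Suc n + Suc n div 2))" by (auto simp: polys_lt_iff)
  moreover have "A0 \<in> polys_lt (Suc (Suc n + Suc n div 2))"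
    using A0 by (auto simp: polys_lt_Suc)
  ultimately have "A0 + \<phi> * B \<in> polys_lt (Suc (Suc n + Suc n div 2))"
    by (rule polys_lt_add[rotated])
  moreover have "A \<in> polys_lt (Suc n + (Suc n - 1) div 2)" using A by simp
  moreover have "eval2 P z = curve_fun (A0 + \<phi> * B) A z" if "z \<in> curve \<phi>" for z
    using AB[OF that] that
    by (cases z) (auto simp: P curve_fun_def curve_def power2_eq_square algebra_simps)
  ultimately show ?case by blast
qed

text \<open>The converse reduction: in \<open>A = \<phi> * Q + R\<close> the factor
  \<open>\<phi>\<close> is replaced by \<open>y^2\<close>. This trades three degrees for two, hence
  an induction in steps of two.\<close>

lemma poly_eq_eval2:
  assumes phi: "degree \<phi> = 3"
    and "A \<in> polys_lt (Suc (n + n div 2))"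
  shows "\<exists>P. total_degree_le P n \<and> (\<forall>(x, y)\<in>curve \<phi>. eval2 P (x, y) = poly A x)"
  using assms(2)
proof (induction n arbitrary: A rule: induct_nat_012)
  case 0
  then show ?case by (intro exI[of _ "[:A:]"]) (auto simp: polys_lt_Suc total_degree_le_const)
next
  case 1
  then show ?case by (intro exI[of _ "[:A:]"]) (auto simp: polys_lt_Suc total_degree_le_const)
next
  case (ge2 n)
  define Q R where "Q = A div \<phi>" and "R = A mod \<phi>"
  have A: "A = \<phi> * Q + R" by (simp add: Q_def R_def)
  have R: "degree R < 3"
    using degree_mod_less[of \<phi> A] phi by (fastforce simp: R_def)
  have "Q \<in> polys_lt (Suc (n + n div 2))"
  proof (cases "Q = 0")
    case False
    have "degree (\<phi> * Q) = 3 + degree Q"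
      using False phi by (subst degree_mult_eq) auto
    then have "degree A = 3 + degree Q"
      unfolding A using R by (subst degree_add_eq_left) auto
    with ge2.prems show ?thesis by (auto simp: polys_lt_Suc)
  qed simp
  with ge2.IH(1) obtain P where P: "total_degree_le P n"
    "\<And>x y. (x, y) \<in> curve \<phi> \<Longrightarrow> eval2 P (x, y) = poly Q x" by fast
  have "total_degree_le (pCons R (pCons 0 P)) (Suc (Suc n))"
    using P(1) R by (simp add: total_degree_le_pCons_Suc)
  moreover have "eval2 (pCons R (pCons 0 P)) (x, y) = poly A x" if "(x, y) \<in> curve \<phi>" for x y
    using P(2)[OF that] that by (simp add: A curve_def power2_eq_square)
  ultimately show ?case by blast
qed

lemma Pi_curve_eq:
  assumes phi: "degree \<phi> = 3"
  shows "Pi_curve \<phi> n = {restrict (curve_fun A B) (curve \<phi>) | A B.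
           A \<in> polys_lt (Suc (n + n div 2)) \<and> B \<in> polys_lt (n + (n - 1) div 2)}"
proof (intro subset_antisym subsetI)
  fix F assume "F \<in> Pi_curve \<phi> n"
  then obtain P where P: "total_degree_le P n" "F = restrict (eval2 P) (curve \<phi>)"
    by (auto simp: Pi_curve_def)
  with eval2_eq_curve_fun[OF phi P(1)]
  show "F \<in> {restrict (curve_fun A B) (curve \<phi>) | A B.
           A \<in> polys_lt (Suc (n + n div 2)) \<and> B \<in> polys_lt (n + (n - 1) div 2)}"
    by (auto intro!: restrict_ext)
next
  fix F assume "F \<in> {restrict (curve_fun A B) (curve \<phi>) | A B.
           A \<in> polys_lt (Suc (n + n div 2)) \<and> B \<in> polys_lt (n + (n - 1) div 2)}"
  then obtain A B where A: "A \<in> polys_lt (Suc (n + n div 2))"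
    and B: "B \<in> polys_lt (n + (n - 1) div 2)" and F: "F = restrict (curve_fun A B) (curve \<phi>)"
    by blast
  from poly_eq_eval2[OF phi A] obtain P where P: "total_degree_le P n"
    "\<And>x y. (x, y) \<in> curve \<phi> \<Longrightarrow> eval2 P (x, y) = poly A x" by fast
  \<comment> \<open>For \<open>n = Suc k\<close> the bound on \<open>B\<close> is the even-part
    bound for \<open>k\<close>, and the factor \<open>y\<close> raises \<open>k\<close> to
    \<open>n\<close>; for \<open>n = 0\<close> it forces \<open>B = 0\<close>.\<close>
  have "\<exists>Q. total_degree_le Q n \<and> (\<forall>(x, y)\<in>curve \<phi>. eval2 Q (x, y) = y * poly B x)"
  proof (cases n)
    case 0
    with B show ?thesis by (intro exI[of _ 0]) (auto simp: total_degree_le_def)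
  next
    case (Suc k)
    with B have "B \<in> polys_lt (Suc (k + k div 2))" by simp
    from poly_eq_eval2[OF phi this] obtain Q where Q: "total_degree_le Q k"
      "\<And>x y. (x, y) \<in> curve \<phi> \<Longrightarrow> eval2 Q (x, y) = poly B x" by fast
    then show ?thesis unfolding Suc
      by (intro exI[of _ "pCons 0 Q"]) (auto simp: total_degree_le_pCons_Suc)
  qed
  then obtain Q where Q: "total_degree_le Q n"
    "\<And>x y. (x, y) \<in> curve \<phi> \<Longrightarrow> eval2 Q (x, y) = y * poly B x" by fast
  have "F = restrict (eval2 (P + Q)) (curve \<phi>)"
    unfolding F using P(2) Q(2) by (intro restrict_ext) (auto simp: curve_fun_def)
  then show "F \<in> Pi_curve \<phi> n"
    using total_degree_le_add[OF P(1) Q(1)] unfolding Pi_curve_def by blast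
qed

text \<open>For even \<open>n = 2 m\<close> the odd part of \<^term>\<open>Pi_curve \<phi> n\<close> only reaches degree \<open>3 m - 2\<close>;
  the adjoined function supplies the missing degree \<open>3 m - 1\<close>.\<close>

lemma interp_space_eq:
  assumes phi: "degree \<phi> = 3" and q: "\<And>k. q k \<noteq> 0 \<and> degree (q k) = k"
  shows "interp_space \<phi> q n = {restrict (curve_fun A B) (curve \<phi>) | A B.
           A \<in> polys_lt (Suc (num_nodes n)) \<and> B \<in> polys_lt (num_nodes n)}"
    (is "_ = ?V")
proof (cases "odd n")
  case True
  then obtain m where "n = 2 * m + 1" by (elim oddE)
  then have "Suc (n + n div 2) = Suc (num_nodes n)" "n + (n - 1) div 2 = num_nodes n"
    by (auto simp: num_nodes_def)
  then show ?thesis using True by (simp add: interp_space_def Pi_curve_eq[OF phi])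
next
  case False
  then obtain m where n: "n = 2 * m" by (auto elim: evenE)
  have N: "num_nodes n = 3 * m" by (simp add: num_nodes_def n)
  have A: "Suc (n + n div 2) = Suc (3 * m)" by (simp add: n)
  have B: "n + (n - 1) div 2 = 3 * m - 1" by (cases m) (auto simp: n)
  have V: "interp_space \<phi> q n = {restrict (\<lambda>z. F z + c * Y_odd3 q m z) (curve \<phi>) | F c.
      \<exists>A B. F = restrict (curve_fun A B) (curve \<phi>) \<and> A \<in> polys_lt (Suc (3 * m)) \<and>
        B \<in> polys_lt (3 * m - 1)}"
    unfolding interp_space_def adjoin_def Pi_curve_eq[OF phi] A B using False by (simp add: n)
  \<comment> \<open>For \<open>m = 0\<close> the truncated index \<open>3 * m - 1\<close> is 0 and
    would select the nonzero constant \<open>q 0\<close>, so the zero convention is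
    explicit.\<close>
  define q' where "q' = (if m = 0 then 0 else q (3 * m - 1))"
  have Y: "restrict (\<lambda>z. restrict (curve_fun A B) (curve \<phi>) z + c * Y_odd3 q m z) (curve \<phi>) =
      restrict (curve_fun A (B + smult c q')) (curve \<phi>)" for A B c
    by (rule restrict_ext) (auto simp: curve_fun_def Y_odd3_def q'_def algebra_simps)
  have q': "q' \<in> polys_lt (3 * m)"
    using q[of "3 * m - 1"] by (auto simp: q'_def polys_lt_iff)
  show ?thesis
  proof (intro subset_antisym subsetI)
    fix F assume "F \<in> interp_space \<phi> q n"
    then obtain A B c where "F = restrict (curve_fun A (B + smult c q')) (curve \<phi>)"
      "A \<in> polys_lt (Suc (3 * m))" "B \<in> polys_lt (3 * m - 1)"
      unfolding V using Y by auto
    moreover from this(3) have "B + smult c q' \<in> polys_lt (3 * m)"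
      by (intro polys_lt_add polys_lt_smult q') (auto intro: polys_lt_mono)
    ultimately show "F \<in> ?V" unfolding N by blast
  next
    fix F assume "F \<in> ?V"
    then obtain A B where F: "F = restrict (curve_fun A B) (curve \<phi>)"
      "A \<in> polys_lt (Suc (3 * m))" "B \<in> polys_lt (3 * m)" unfolding N by blast
    have "\<exists>C c. C \<in> polys_lt (3 * m - 1) \<and> B = C + smult c q'"
    proof (cases "m = 0")
      case True
      with F(3) show ?thesis by (auto simp: q'_def)
    next
      case False
      \<comment> \<open>\<open>q (3 * m - 1)\<close> has exact degree, so a multiple of it absorbs
        the top coefficient of \<open>B\<close>.\<close>
      then have "B \<in> polys_lt (Suc (3 * m - 1))" using F(3) by simp
      then obtain c C where "C \<in> polys_lt (3 * m - 1)" "B = C + smult c (q (3 * m - 1))"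
        using polys_lt_split_leading q by metis
      then show ?thesis using False by (auto simp: q'_def)
    qed
    then obtain C c where C: "C \<in> polys_lt (3 * m - 1)" "B = C + smult c q'" by blast
    have "F = restrict (\<lambda>z. restrict (curve_fun A C) (curve \<phi>) z + c * Y_odd3 q m z) (curve \<phi>)"
      unfolding Y F(1) C(2) ..
    then show "F \<in> interp_space \<phi> q n" unfolding V using F(2) C(1) by blast
  qed
qed

section \<open>Interpolation on the curve\<close>

text \<open>\<open>p N\<close> lies in the space and vanishes at all nodes, so interpolation alone
  leaves a one-parameter family; orthogonality of the even part to \<open>p N\<close> selects one
  member. The assumption on the zeros keeps them out of a possible gap between components of
  \<open>Omega \<phi>\<close>.\<close>

theorem theorem3p2:
  fixes a0 a1 a2 a3 :: real and \<phi> :: "real poly" and w :: "real \<Rightarrow> real"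
    and p q :: "nat \<Rightarrow> real poly" and f :: "real \<times> real \<Rightarrow> real" and n N :: nat
  assumes "a0 > 0"
    and "\<phi> = [:a3, a2, a1, a0:]"
    and "weight_on (Omega \<phi>) w"
    and "orthogonal_polys (Omega \<phi>) w p"
    and "orthogonal_polys (Omega \<phi>) (\<lambda>x. poly \<phi> x * w x) q"
    and "continuous_on (curve \<phi>) f"
    and "N = num_nodes n"
    and "\<forall>x. poly (p N) x = 0 \<longrightarrow> x \<in> Omega \<phi>"
  shows "(let L = curve_interp \<phi> p n f; V = interp_space \<phi> q n in
      (\<exists>P. L = eval2 P) \<and>
      interpolates \<phi> (p N) N f L \<and>
      restrict L (curve \<phi>) \<in> V \<and>
      {F \<in> V. interpolates \<phi> (p N) N f F} =
        {restrict (\<lambda>(x, y). L (x, y) + c * poly (p N) x) (curve \<phi>) | c. True} \<and>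
      (\<forall>F. F \<in> V \<and> interpolates \<phi> (p N) N f F \<and>
            inner_w (Omega \<phi>) w (even_part \<phi> F) (poly (p N)) = 0
          \<longleftrightarrow> F = restrict L (curve \<phi>)))"
proof -
  note w = assms(3) and p = assms(4) and N = assms(7)
  have phi: "degree \<phi> = 3" using assms(1,2) by simp
  have p0: "p N \<noteq> 0" and dp: "degree (p N) = N" using p by (auto simp: orthogonal_polys_def)
  have card: "card {x. poly (p N) x = 0} = N" using w p by (rule card_roots_orthogonal_poly)
  have nodes: "node (p N) ` {1..N} = {x. poly (p N) x = 0}" using node_image[OF p0] card by simp
  have pos: "poly \<phi> x > 0" if "poly (p N) x = 0" for x
    using assms(8) that by (simp add: Omega_def)
  have on_curve: "(x, sqrt (poly \<phi> x)) \<in> curve \<phi>" "(x, - sqrt (poly \<phi> x)) \<in> curve \<phi>"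
    if "poly \<phi> x > 0" for x using that by (auto simp: curve_def)
  define E D where "E = lagrange p N (even_part \<phi> f)" and "D = lagrange p N (odd_part \<phi> f)"
  note lag = lagrange_props[of p, OF p0 card]
  have E: "E \<in> polys_lt N" and D: "D \<in> polys_lt N" by (simp_all add: E_def D_def lag(1))
  have L: "curve_interp \<phi> p n f = curve_fun E D"
    by (simp add: curve_interp_def curve_fun_def E_def D_def N)
  define V where "V = interp_space \<phi> q n"
  have V: "V = {restrict (curve_fun A B) (curve \<phi>) | A B. A \<in> polys_lt (Suc N) \<and> B \<in> polys_lt N}"
    unfolding V_def N by (rule interp_space_eq[OF phi])
      (use assms(5) in \<open>auto simp: orthogonal_polys_def\<close>)
  \<comment> \<open>Agreement is asked only on the curve, so this applies both to
    \<open>curve_fun E D\<close> itself and to restricted functions.\<close>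
  have interp: "interpolates \<phi> (p N) N f F \<longleftrightarrow>
      (\<forall>x. poly (p N) x = 0 \<longrightarrow> poly A x = poly E x \<and> poly B x = poly D x)"
    if F: "\<And>z. z \<in> curve \<phi> \<Longrightarrow> F z = curve_fun A B z" for F A B
  proof -
    have "interpolates \<phi> (p N) N f F \<longleftrightarrow> (\<forall>x\<in>node (p N) ` {1..N}.
        F (x, sqrt (poly \<phi> x)) = f (x, sqrt (poly \<phi> x)) \<and>
        F (x, - sqrt (poly \<phi> x)) = f (x, - sqrt (poly \<phi> x)))"
      by (simp add: interpolates_def Let_def)
    also have "\<dots> \<longleftrightarrow> (\<forall>x. poly (p N) x = 0 \<longrightarrow>
        F (x, sqrt (poly \<phi> x)) = f (x, sqrt (poly \<phi> x)) \<and>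
        F (x, - sqrt (poly \<phi> x)) = f (x, - sqrt (poly \<phi> x)))"
      unfolding nodes by simp
    also have "\<dots> \<longleftrightarrow> (\<forall>x. poly (p N) x = 0 \<longrightarrow> poly A x = poly E x \<and> poly B x = poly D x)"
    proof (intro all_cong1 imp_cong refl)
      fix x assume x: "poly (p N) x = 0"
      define s where "s = sqrt (poly \<phi> x)"
      \<comment> \<open>Since \<open>s\<close> is nonzero, the sum and difference of the two
        conditions determine \<open>A\<close> and \<open>B\<close> at \<open>x\<close>.\<close>
      have s: "s > 0" using pos[OF x] by (simp add: s_def)
      have "poly E x = (f (x, s) + f (x, - s)) / 2" "poly D x = (f (x, s) - f (x, - s)) / (2 * s)"
        using lag(2)[OF x] by (simp_all add: E_def D_def even_part_def odd_part_def s_def)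
      then have "f (x, s) = poly E x + s * poly D x" "f (x, - s) = poly E x - s * poly D x"
        using s by (simp_all add: field_simps)
      moreover have "F (x, s) = poly A x + s * poly B x" "F (x, - s) = poly A x - s * poly B x"
        using F on_curve[OF pos[OF x]] by (simp_all add: s_def curve_fun_def)
      ultimately show "(F (x, sqrt (poly \<phi> x)) = f (x, sqrt (poly \<phi> x)) \<and>
          F (x, - sqrt (poly \<phi> x)) = f (x, - sqrt (poly \<phi> x))) \<longleftrightarrow>
          poly A x = poly E x \<and> poly B x = poly D x"
        unfolding s_def[symmetric] using s
        by (smt (verit, ccfv_threshold) mult_cancel_left)
    qed
    finally show ?thesis .
  qed
  have family: "restrict (\<lambda>(x, y). curve_fun E D (x, y) + c * poly (p N) x) (curve \<phi>) =
      restrict (curve_fun (E + smult c (p N)) D) (curve \<phi>)" for c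
    by (rule restrict_ext) (auto simp: curve_fun_def)
  \<comment> \<open>\<open>A\<close> has \<open>N + 1\<close> free coefficients and \<open>B\<close>
    has \<open>N\<close>, against \<open>2 N\<close> conditions; the surplus is the multiple of
    \<open>p N\<close>.\<close>
  have solutions: "{F \<in> V. interpolates \<phi> (p N) N f F} =
      {restrict (curve_fun (E + smult c (p N)) D) (curve \<phi>) | c. True}"
  proof (intro subset_antisym subsetI)
    fix F assume "F \<in> {F \<in> V. interpolates \<phi> (p N) N f F}"
    then obtain A B where F: "F = restrict (curve_fun A B) (curve \<phi>)"
      and A: "A \<in> polys_lt (Suc N)" and B: "B \<in> polys_lt N"
      and "interpolates \<phi> (p N) N f F" unfolding V by blast
    with interp[of F A B]
    have eq: "poly A x = poly E x" "poly B x = poly D x" if "poly (p N) x = 0" for x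
      using that by auto
    have "B - D = 0"
      using eq card B D by (intro polys_lt_eq_0[of _ "{x. poly (p N) x = 0}"] polys_lt_diff) auto
    \<comment> \<open>\<open>p N\<close> vanishes at the nodes, so \<open>R\<close> still agrees
      with \<open>E\<close> there.\<close>
    moreover obtain c R where R: "R \<in> polys_lt N" "A = R + smult c (p N)"
      using polys_lt_split_leading[OF A p0 dp] .
    moreover have "R - E = 0"
      using eq(1) card R E
      by (intro polys_lt_eq_0[of _ "{x. poly (p N) x = 0}"] polys_lt_diff) auto
    ultimately show "F \<in> {restrict (curve_fun (E + smult c (p N)) D) (curve \<phi>) | c. True}"
      using F by auto
  next
    fix F assume "F \<in> {restrict (curve_fun (E + smult c (p N)) D) (curve \<phi>) | c. True}"
    then obtain c where F: "F = restrict (curve_fun (E + smult c (p N)) D) (curve \<phi>)" by blast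
    have "E + smult c (p N) \<in> polys_lt (Suc N)"
      using dp by (intro polys_lt_add polys_lt_smult polys_lt_mono[OF E]) (auto simp: polys_lt_Suc)
    then have "F \<in> V" unfolding V F using D by blast
    moreover have "interpolates \<phi> (p N) N f F"
      by (subst interp[of F "E + smult c (p N)" D]) (auto simp: F)
    ultimately show "F \<in> {F \<in> V. interpolates \<phi> (p N) N f F}" by simp
  qed
  have inner: "inner_w (Omega \<phi>) w
      (even_part \<phi> (restrict (curve_fun (E + smult c (p N)) D) (curve \<phi>))) (poly (p N)) =
      c * inner_w (Omega \<phi>) w (poly (p N)) (poly (p N))" for c
  proof -
    \<comment> \<open>Over \<open>Omega \<phi>\<close> both points lie on the curve, so
      \<open>restrict\<close> has no effect and the odd parts cancel; the integral sees no other
      \<open>x\<close>.\<close>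
    have "even_part \<phi> (restrict (curve_fun A B) (curve \<phi>)) x = poly A x" if "x \<in> Omega \<phi>" for A B x
      using on_curve[of x] that by (simp add: even_part_def curve_fun_def Omega_def)
    moreover have "Omega \<phi> \<in> sets lebesgue"
      unfolding Omega_def
      by (intro sets_completionI_sets) (simp add: borel_open open_Collect_less continuous_on_poly)
    ultimately have "inner_w (Omega \<phi>) w
      (even_part \<phi> (restrict (curve_fun (E + smult c (p N)) D) (curve \<phi>))) (poly (p N)) =
      inner_w (Omega \<phi>) w (poly (E + smult c (p N))) (poly (p N))"
      unfolding inner_w_def by (intro set_lebesgue_integral_cong) auto
    then show ?thesis
      by (simp only: inner_w_add_smult[OF w] orthogonal_polys_polys_lt[OF w p E] add_0)
  qed
  have nz: "inner_w (Omega \<phi>) w (poly (p N)) (poly (p N)) \<noteq> 0"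
    using w p0 by (rule inner_w_self_neq_0)
  have "F \<in> V \<and> interpolates \<phi> (p N) N f F \<and>
      inner_w (Omega \<phi>) w (even_part \<phi> F) (poly (p N)) = 0
      \<longleftrightarrow> F = restrict (curve_fun E D) (curve \<phi>)" for F
  proof -
    have sol: "F \<in> V \<and> interpolates \<phi> (p N) N f F \<longleftrightarrow>
        (\<exists>c. F = restrict (curve_fun (E + smult c (p N)) D) (curve \<phi>))"
      using solutions by blast
    have "F \<in> V \<and> interpolates \<phi> (p N) N f F \<and>
        inner_w (Omega \<phi>) w (even_part \<phi> F) (poly (p N)) = 0 \<longleftrightarrow>
        (\<exists>c. F = restrict (curve_fun (E + smult c (p N)) D) (curve \<phi>) \<and>
          inner_w (Omega \<phi>) w (even_part \<phi>
            (restrict (curve_fun (E + smult c (p N)) D) (curve \<phi>))) (poly (p N)) = 0)"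
      unfolding conj_assoc[symmetric] sol by auto
    also have "\<dots> \<longleftrightarrow>
        (\<exists>c. F = restrict (curve_fun (E + smult c (p N)) D) (curve \<phi>) \<and> c = 0)"
      unfolding inner using nz by simp
    finally show ?thesis by simp
  qed
  moreover have "interpolates \<phi> (p N) N f (curve_fun E D)"
    by (subst interp[of _ E D]) auto
  moreover have "restrict (curve_fun E D) (curve \<phi>) \<in> V"
    unfolding V using polys_lt_mono[OF E, of "Suc N"] D by auto
  moreover have "\<exists>P. curve_fun E D = eval2 P" using curve_fun_eq_eval2 by blast
  ultimately show ?thesis
    unfolding Let_def V_def[symmetric] L family solutions by blast
qed

end
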